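(* Let $p_G$ be the Ising model described in the context, satisfying the strongly ferromagnetic assumption with constants $h_G,J_0$. Let $\delta\in(0,1)$ and $M\in\mathbb{N}_+$. Suppose in addition $$|C_G|\ge8\Big(1+\ln\frac{4M}{\delta}\Big),\qquad h_G\ge\frac12\ln\frac{2(4-\delta)}{\delta},\qquad J_0\ge\frac12|C_G|\ln2,$$ and $$k\ge\max\Big\{|C_G|,\ N-\delta\frac{N+1}{(4-\delta)|C_G|+\delta}\Big\},$$ and that the initial state $X^{(0)}\in\{-1,1\}^N$ satisfies $\sum_{i\in C_G}X_i^{(0)}\le-2$. Then with probability at least $1-\delta$, both of the following hold: 1. running the $k$-Gibbs sampler from $X^{(0)}$: $X^{(1)}_{k\text{-Gibbs}}\in\mathcal{R}_1$; and 2. running the independent parallel sampler from $X^{(0)}$: $\{X^{(t)}_{indep}: t\in[M]\}\cap\mathcal{R}_1=\emptyset$.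
   Context: Ising model: $C_G\subseteq[N]$ with $|C_G|\ge2$, $\mathbf{h}\in\mathbb{R}^N$, $J>0$, and $p_G$ is the distribution on $\{-1,1\}^N$ with $$p_G(x)\propto\exp\Big(\sum_{i\in[N]}\mathbf{h}_ix_i+\sum_{\{i,j\}\subseteq C_G,\,i\ne j}Jx_ix_j\Big)$$ (each unordered pair counted once), where $\sum_{i\in C_G}\mathbf{h}_i>0$. Strongly ferromagnetic assumption: with $h_G:=\sum_{i\in C_G}\mathbf{h}_i$, one has $h_G>\sum_{i\notin C_G}|\mathbf{h}_i|$ and $h_G>0$, and $J_0>0$ is a constant with $J-\|\mathbf{h}\|_1\ge J_0$. $\mathcal{R}_1=\{x\in\{-1,1\}^N:x_i=1\ \forall i\in C_G\}$. $k$-Gibbs sampler ($k\le N$): at each step choose $K\subseteq[N]$ uniformly among subsets of size $k$, set $X^{(t+1)}_{-K}=X^{(t)}_{-K}$ and draw $X^{(t+1)}_K\sim p_G(\cdot\mid X^{(t)}_{-K})$, where $X_K=(X_i)_{i\in K}$, $X_{-K}=(X_i)_{i\notin K}$. Independent parallel sampler: at each step, for all $i\in[N]$ independently given $X^{(t)}$, draw $X^{(t+1)}_i\sim p_G(\cdot\mid X^{(t)}_{-\{i\}})$. $[M]=\{1,\dots,M\}$. *)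

theory Defs
  imports "HOL-Probability.Probability"
begin

type_synonym config = "nat \<Rightarrow> real"

definition configs :: "nat \<Rightarrow> config set" where
  "configs N = PiE {1..N} (\<lambda>_. {-1, 1})"

text \<open>The index set of the second sum lists every unordered pair in \<open>C\<close> exactly once.\<close>

definition ising_exponent :: "nat \<Rightarrow> nat set \<Rightarrow> (nat \<Rightarrow> real) \<Rightarrow> real \<Rightarrow> config \<Rightarrow> real" where
  "ising_exponent N C h J x =
     (\<Sum>i=1..N. h i * x i) + (\<Sum>(i, j)\<in>{(i, j). i \<in> C \<and> j \<in> C \<and> i < j}. J * x i * x j)"

definition ising_partition :: "nat \<Rightarrow> nat set \<Rightarrow> (nat \<Rightarrow> real) \<Rightarrow> real \<Rightarrow> real" where
  "ising_partition N C h J = (\<Sum>x\<in>configs N. exp (ising_exponent N C h J x))"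

definition ising_pmf :: "nat \<Rightarrow> nat set \<Rightarrow> (nat \<Rightarrow> real) \<Rightarrow> real \<Rightarrow> config pmf" where
  "ising_pmf N C h J =
     embed_pmf (\<lambda>x. if x \<in> configs N
                     then exp (ising_exponent N C h J x) / ising_partition N C h J else 0)"

lemma finite_configs: "finite (configs N)"
  by (auto simp: configs_def intro: finite_PiE)

lemma configs_nonempty: "configs N \<noteq> {}"
  by (auto simp: configs_def PiE_eq_empty_iff)

lemma ising_partition_pos: "ising_partition N C h J > 0"
  unfolding ising_partition_def
  by (intro sum_pos finite_configs configs_nonempty) auto

lemma pmf_ising_pmf:
  "pmf (ising_pmf N C h J) x =
     (if x \<in> configs N then exp (ising_exponent N C h J x) / ising_partition N C h J else 0)"
  unfolding ising_pmf_def
proof (rule pmf_embed_pmf)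
  let ?f = "\<lambda>x. if x \<in> configs N
                 then exp (ising_exponent N C h J x) / ising_partition N C h J else 0"
  show "0 \<le> ?f y" for y
    using ising_partition_pos[of N C h J] by auto
  have "(\<integral>\<^sup>+y. ennreal (?f y) \<partial>count_space UNIV) = (\<Sum>y\<in>configs N. ennreal (?f y))"
    by (rule nn_integral_count_space'[OF finite_configs]) auto
  also have "\<dots> = ennreal (\<Sum>y\<in>configs N. ?f y)"
    using ising_partition_pos[of N C h J] by (intro sum_ennreal) auto
  also have "(\<Sum>y\<in>configs N. ?f y) = 1"
    using ising_partition_pos[of N C h J]
    by (simp add: ising_partition_def flip: sum_divide_distrib)
  finally show "(\<integral>\<^sup>+y. ennreal (?f y) \<partial>count_space UNIV) = 1"
    by simp
qed

lemma set_ising_pmf: "set_pmf (ising_pmf N C h J) = configs N"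
  using ising_partition_pos[of N C h J] by (auto simp: set_pmf_iff pmf_ising_pmf split: if_splits)

text \<open>
  The law of a full configuration obtained from \<open>x\<close> by keeping the coordinates outside \<open>K\<close>
  and drawing those in \<open>K\<close> from \<open>p\<close> conditioned on \<open>x\<close> outside \<open>K\<close>.
\<close>

definition resample :: "nat \<Rightarrow> config pmf \<Rightarrow> nat set \<Rightarrow> config \<Rightarrow> config pmf" where
  "resample N p K x = cond_pmf p {y. \<forall>i\<in>{1..N} - K. y i = x i}"

definition k_gibbs_kernel :: "nat \<Rightarrow> config pmf \<Rightarrow> nat \<Rightarrow> config \<Rightarrow> config pmf" where
  "k_gibbs_kernel N p k x =
     bind_pmf (pmf_of_set {K. K \<subseteq> {1..N} \<and> card K = k}) (\<lambda>K. resample N p K x)"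

text \<open>The conditioning event below has positive probability whenever \<open>x\<close> is a configuration.\<close>

lemma pmf_resample_ising:
  assumes "x \<in> configs N"
  shows "pmf (resample N (ising_pmf N C h J) K x) y =
    (if \<forall>i\<in>{1..N} - K. y i = x i
     then pmf (ising_pmf N C h J) y /
          measure (measure_pmf (ising_pmf N C h J)) {z. \<forall>i\<in>{1..N} - K. z i = x i} else 0)"
proof -
  have "x \<in> set_pmf (ising_pmf N C h J) \<inter> {z. \<forall>i\<in>{1..N} - K. z i = x i}"
    using assms by (simp add: set_ising_pmf)
  then have "set_pmf (ising_pmf N C h J) \<inter> {z. \<forall>i\<in>{1..N} - K. z i = x i} \<noteq> {}"
    by blast
  from pmf_cond[OF this] show ?thesis
    by (simp add: resample_def)
qed

text \<open>The default value \<open>undefined\<close> outside \<open>{1..N}\<close> makes the result extensional, hence in \<open>configs N\<close>.\<close>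

definition indep_parallel_kernel :: "nat \<Rightarrow> config pmf \<Rightarrow> config \<Rightarrow> config pmf" where
  "indep_parallel_kernel N p x =
     Pi_pmf {1..N} undefined (\<lambda>i. map_pmf (\<lambda>y. y i) (resample N p {i} x))"

text \<open>
  \<open>X\<close> is a time-homogeneous Markov chain on the countable state space \<open>S\<close>, started in \<open>x0\<close>,
  with transition law \<open>\<kappa>\<close>.  The factorisation over finite paths states the Markov property
  with respect to the history of \<open>X\<close> without dividing by probabilities of null events.
\<close>

definition markov_chain_from ::
  "'w measure \<Rightarrow> 's set \<Rightarrow> ('s \<Rightarrow> 's pmf) \<Rightarrow> 's \<Rightarrow> (nat \<Rightarrow> 'w \<Rightarrow> 's) \<Rightarrow> bool" where
  "markov_chain_from \<Omega> S \<kappa> x0 X \<longleftrightarrow>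
     (\<forall>t. X t \<in> measurable \<Omega> (count_space S)) \<and>
     (AE \<omega> in \<Omega>. X 0 \<omega> = x0) \<and>
     (\<forall>\<xi> t. range \<xi> \<subseteq> S \<longrightarrow>
        measure \<Omega> {\<omega> \<in> space \<Omega>. \<forall>s\<le>Suc t. X s \<omega> = \<xi> s} =
        measure \<Omega> {\<omega> \<in> space \<Omega>. \<forall>s\<le>t. X s \<omega> = \<xi> s} * pmf (\<kappa> (\<xi> t)) (\<xi> (Suc t)))"

definition region1 :: "nat \<Rightarrow> nat set \<Rightarrow> config set" where
  "region1 N C = {x \<in> configs N. \<forall>i\<in>C. x i = 1}"

end

theory Submission
  imports Defs
begin

text \<open>
  On configurations the exponent is
  \<open>(\<Sum>i. h i * x i) + J / 2 * (S\<^sup>2 - card C)\<close> with \<open>S = (\<Sum>i\<in>C. x i)\<close>.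

  Block sampler: \<open>k\<close> is so large that a union bound gives \<open>C \<subseteq> K\<close> with probability at least
  \<open>1 - \<delta> / (4 - \<delta>)\<close>.  In that case turning down a set \<open>T \<subseteq> C\<close> of \<open>m\<close> spins of an
  all-up block multiplies the weight by \<open>exp (- 2 * h(T) - 2 * J * m * (card C - m))\<close>, whatever the
  spins outside \<open>K\<close>; the sum of these factors is at most \<open>4 / (4 - \<delta>)\<close>, so all of \<open>C\<close> is up
  with probability at least \<open>(4 - \<delta>) / 4\<close>.  The product of the two bounds is \<open>1 - \<delta> / 2\<close>.

  Parallel sampler: if \<open>S \<le> -2\<close>, the other spins of \<open>C\<close> sum to at most \<open>-1\<close> at every site of \<open>C\<close>,
  so the spin there comes up with probability at most \<open>exp (- 2 * J0)\<close>.  Unless this happens somewhere in the block, the next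
  state again has \<open>S \<le> -2\<close>.  Hence this set, disjoint from the all-up region, is left
  within \<open>M\<close> steps with probability at most \<open>M * card C * exp (- 2 * J0) \<le> \<delta> / 2\<close>.
\<close>

subsection \<open>Finite Markov chains\<close>

text \<open>The chain is specified by factorisation over whole paths. Summing it over the finitely
  many paths up to time \<open>t\<close> that end in \<open>x\<close> removes the history, because
  the transition factor depends on the last state alone.\<close>

lemma markov_chain_from_step:
  assumes "prob_space \<Omega>" and mc: "markov_chain_from \<Omega> S \<kappa> x0 X" and fin: "finite S"
    and x: "x \<in> S" and y: "y \<in> S"
  shows "measure \<Omega> {\<omega> \<in> space \<Omega>. X t \<omega> = x \<and> X (Suc t) \<omega> = y} =
         measure \<Omega> {\<omega> \<in> space \<Omega>. X t \<omega> = x} * pmf (\<kappa> x) y"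
proof -
  interpret prob_space \<Omega> by fact
  have meas [measurable]: "X s \<in> measurable \<Omega> (count_space S)" for s
    using mc by (simp add: markov_chain_from_def)
  have inS: "X s \<omega> \<in> S" if "\<omega> \<in> space \<Omega>" for s \<omega>
    using measurable_space[OF meas that] by simp
  have ev: "{\<omega> \<in> space \<Omega>. X s \<omega> = z} \<in> sets \<Omega>" if "z \<in> S" for s z
    using measurable_sets[OF meas, of "{z}" s] that
    by (simp add: vimage_def Int_def conj_commute)
  \<comment> \<open>Paths are extensional on \<open>{..t}\<close>, so distinct ones differ at some
    time \<open>s \<le> t\<close> and their events \<open>E f\<close> are disjoint.\<close>
  define P where "P = {f \<in> PiE {..t} (\<lambda>_. S). f t = x}"
  define E where "E f = {\<omega> \<in> space \<Omega>. \<forall>s\<le>t. X s \<omega> = f s}" for f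
  define F where "F = {\<omega> \<in> space \<Omega>. X (Suc t) \<omega> = y}"
  have finP: "finite P"
    unfolding P_def by (rule finite_subset[OF _ finite_PiE[of "{..t}" "\<lambda>_. S"]]) (use fin in auto)
  have PS: "f s \<in> S" if "f \<in> P" "s \<le> t" for f s
    using that by (auto simp: P_def PiE_def Pi_def)
  have E_sets: "E f \<in> sets \<Omega>" if "f \<in> P" for f
  proof -
    have "E f = (\<Inter>s\<in>{..t}. {\<omega> \<in> space \<Omega>. X s \<omega> = f s})"
      by (auto simp: E_def)
    then show ?thesis
      using ev PS[OF that] by (auto intro!: sets.finite_INT)
  qed
  have F_sets: "F \<in> sets \<Omega>"
    using ev[OF y] by (simp add: F_def)
  have disj: "disjoint_family_on E P"
  proof (unfold disjoint_family_on_def, intro ballI impI)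
    fix f g assume fg: "f \<in> P" "g \<in> P" "f \<noteq> g"
    then have ex: "f \<in> extensional {..t}" "g \<in> extensional {..t}"
      by (auto simp: P_def PiE_def)
    obtain s where "s \<le> t" "f s \<noteq> g s"
      using extensionalityI[OF ex] fg(3) by auto
    then show "E f \<inter> E g = {}"
      by (auto simp: E_def)
  qed
  have un: "{\<omega> \<in> space \<Omega>. X t \<omega> = x} = (\<Union>f\<in>P. E f)"
  proof (intro equalityI subsetI)
    fix \<omega> assume w: "\<omega> \<in> {\<omega> \<in> space \<Omega>. X t \<omega> = x}"
    then have "restrict (\<lambda>s. X s \<omega>) {..t} \<in> P"
      using inS by (auto simp: P_def)
    moreover have "\<omega> \<in> E (restrict (\<lambda>s. X s \<omega>) {..t})"
      using w by (auto simp: E_def)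
    ultimately show "\<omega> \<in> (\<Union>f\<in>P. E f)" by blast
  qed (auto simp: E_def P_def)
  have step: "measure \<Omega> (E f \<inter> F) = measure \<Omega> (E f) * pmf (\<kappa> x) y" if f: "f \<in> P" for f
  proof -
    \<comment> \<open>The factorisation speaks of infinite sequences in \<open>S\<close>. The path
      is therefore continued by the constant \<open>y\<close>, which also prescribes the state at
      time \<open>Suc t\<close>.\<close>
    define \<xi> where "\<xi> s = (if s \<le> t then f s else y)" for s
    have r: "range \<xi> \<subseteq> S"
      using PS[OF f] y by (auto simp: \<xi>_def)
    have *: "measure \<Omega> {\<omega> \<in> space \<Omega>. \<forall>s\<le>Suc t. X s \<omega> = \<xi> s} =
        measure \<Omega> {\<omega> \<in> space \<Omega>. \<forall>s\<le>t. X s \<omega> = \<xi> s} * pmf (\<kappa> (\<xi> t)) (\<xi> (Suc t))"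
      using mc r unfolding markov_chain_from_def by blast
    have 1: "{\<omega> \<in> space \<Omega>. \<forall>s\<le>t. X s \<omega> = \<xi> s} = E f"
      by (auto simp: E_def \<xi>_def)
    have 2: "{\<omega> \<in> space \<Omega>. \<forall>s\<le>Suc t. X s \<omega> = \<xi> s} = E f \<inter> F"
      by (auto simp: E_def F_def \<xi>_def le_Suc_eq)
    show ?thesis
      using * f unfolding 1 2 by (simp add: \<xi>_def P_def)
  qed
  have "{\<omega> \<in> space \<Omega>. X t \<omega> = x \<and> X (Suc t) \<omega> = y} = (\<Union>f\<in>P. E f \<inter> F)"
    using un by (auto simp: F_def)
  also have "measure \<Omega> \<dots> = (\<Sum>f\<in>P. measure \<Omega> (E f \<inter> F))"
    using E_sets F_sets disj
    by (intro finite_measure_finite_Union finP) (auto simp: disjoint_family_on_def)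
  also have "\<dots> = (\<Sum>f\<in>P. measure \<Omega> (E f)) * pmf (\<kappa> x) y"
    by (simp add: step sum_distrib_right)
  also have "(\<Sum>f\<in>P. measure \<Omega> (E f)) = measure \<Omega> {\<omega> \<in> space \<Omega>. X t \<omega> = x}"
    unfolding un using E_sets disj by (intro finite_measure_finite_Union[symmetric] finP) auto
  finally show ?thesis .
qed

lemma markov_chain_from_in_sets:
  assumes "markov_chain_from \<Omega> S \<kappa> x0 X" and "D \<subseteq> S"
  shows "{\<omega> \<in> space \<Omega>. X t \<omega> \<in> D} \<in> sets \<Omega>"
proof -
  have "X t \<in> measurable \<Omega> (count_space S)"
    using assms by (simp add: markov_chain_from_def)
  from measurable_sets[OF this, of D] show ?thesis
    using assms by (simp add: vimage_def Int_def conj_commute)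
qed

lemma markov_chain_from_step_set:
  assumes "prob_space \<Omega>" and mc: "markov_chain_from \<Omega> S \<kappa> x0 X" and fin: "finite S"
    and A: "A \<subseteq> S" and D: "D \<subseteq> S"
  shows "measure \<Omega> {\<omega> \<in> space \<Omega>. X t \<omega> \<in> A \<and> X (Suc t) \<omega> \<in> D} =
    (\<Sum>x\<in>A. measure \<Omega> {\<omega> \<in> space \<Omega>. X t \<omega> = x} * measure (measure_pmf (\<kappa> x)) D)"
proof -
  interpret prob_space \<Omega> by fact
  have finA: "finite A" and finD: "finite D"
    using A D fin finite_subset by auto
  let ?G = "\<lambda>(x, y). {\<omega> \<in> space \<Omega>. X t \<omega> = x \<and> X (Suc t) \<omega> = y}"
  have sets: "?G p \<in> sets \<Omega>" if "p \<in> A \<times> D" for p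
  proof -
    obtain x y where p: "p = (x, y)" by (cases p)
    have "{\<omega> \<in> space \<Omega>. X t \<omega> \<in> {x}} \<inter> {\<omega> \<in> space \<Omega>. X (Suc t) \<omega> \<in> {y}} \<in> sets \<Omega>"
      using that A D unfolding p
      by (intro sets.Int markov_chain_from_in_sets[OF mc]) auto
    moreover have "{\<omega> \<in> space \<Omega>. X t \<omega> \<in> {x}} \<inter> {\<omega> \<in> space \<Omega>. X (Suc t) \<omega> \<in> {y}} = ?G p"
      unfolding p by auto
    ultimately show ?thesis by simp
  qed
  have "{\<omega> \<in> space \<Omega>. X t \<omega> \<in> A \<and> X (Suc t) \<omega> \<in> D} = (\<Union>p\<in>A\<times>D. ?G p)"
    by auto
  also have "measure \<Omega> \<dots> = (\<Sum>p\<in>A\<times>D. measure \<Omega> (?G p))"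
    using sets by (intro finite_measure_finite_Union finite_cartesian_product finA finD)
      (auto simp: disjoint_family_on_def)
  also have "\<dots> = (\<Sum>x\<in>A. \<Sum>y\<in>D. measure \<Omega> {\<omega> \<in> space \<Omega>. X t \<omega> = x} * pmf (\<kappa> x) y)"
    unfolding sum.cartesian_product
    using A D by (intro sum.cong refl) (auto intro!: markov_chain_from_step[OF assms(1) mc fin])
  also have "\<dots> = (\<Sum>x\<in>A. measure \<Omega> {\<omega> \<in> space \<Omega>. X t \<omega> = x} * measure (measure_pmf (\<kappa> x)) D)"
    using finD by (simp add: measure_measure_pmf_finite sum_distrib_left)
  finally show ?thesis .
qed

text \<open>The start is \<open>x0\<close> only almost surely. Intersecting with this event of
  probability one changes no probability and turns the claim into a one-step transition out of
  \<open>{x0}\<close>.\<close>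

lemma markov_chain_from_first_step:
  assumes "prob_space \<Omega>" and mc: "markov_chain_from \<Omega> S \<kappa> x0 X" and fin: "finite S"
    and x0: "x0 \<in> S" and D: "D \<subseteq> S"
  shows "measure \<Omega> {\<omega> \<in> space \<Omega>. X 1 \<omega> \<in> D} = measure (measure_pmf (\<kappa> x0)) D"
proof -
  interpret prob_space \<Omega> by fact
  have ae: "AE \<omega> in \<Omega>. X 0 \<omega> = x0"
    using mc by (simp add: markov_chain_from_def)
  have s1: "{\<omega> \<in> space \<Omega>. X s \<omega> \<in> B} \<in> sets \<Omega>" if "B \<subseteq> S" for s B
    using markov_chain_from_in_sets[OF mc that] .
  have "{\<omega> \<in> space \<Omega>. X 0 \<omega> = x0} \<in> sets \<Omega>"
    using s1[of "{x0}" 0] x0 by simp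
  then have one: "measure \<Omega> {\<omega> \<in> space \<Omega>. X 0 \<omega> = x0} = 1"
    using ae by (simp add: prob_Collect_eq_1)
  have "{\<omega> \<in> space \<Omega>. X 0 \<omega> \<in> {x0} \<and> X (Suc 0) \<omega> \<in> D} =
      {\<omega> \<in> space \<Omega>. X 0 \<omega> \<in> {x0}} \<inter> {\<omega> \<in> space \<Omega>. X (Suc 0) \<omega> \<in> D}"
    by blast
  also have "\<dots> \<in> sets \<Omega>"
    using x0 D by (intro sets.Int s1) auto
  finally have "{\<omega> \<in> space \<Omega>. X 0 \<omega> \<in> {x0} \<and> X (Suc 0) \<omega> \<in> D} \<in> sets \<Omega>" .
  then have "measure \<Omega> {\<omega> \<in> space \<Omega>. X 1 \<omega> \<in> D} =
      measure \<Omega> {\<omega> \<in> space \<Omega>. X 0 \<omega> \<in> {x0} \<and> X (Suc 0) \<omega> \<in> D}"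
    using ae s1[OF D] by (intro finite_measure_eq_AE) auto
  also have "\<dots> = measure (measure_pmf (\<kappa> x0)) D"
    using markov_chain_from_step_set[OF assms(1) mc fin, of "{x0}" D 0] x0 D one by simp
  finally show ?thesis .
qed

text \<open>At the first exit time the chain jumps from \<open>A\<close> to its complement. A jump
  at a fixed time has probability at most \<open>\<epsilon>\<close>, being an average of exit
  probabilities with total weight at most one; a union bound over \<open>M\<close> times
  follows.\<close>

lemma markov_chain_from_exit:
  assumes "prob_space \<Omega>" and mc: "markov_chain_from \<Omega> S \<kappa> x0 X" and fin: "finite S"
    and A: "A \<subseteq> S" and x0: "x0 \<in> A"
    and leave: "\<And>x. x \<in> A \<Longrightarrow> measure (measure_pmf (\<kappa> x)) (S - A) \<le> \<epsilon>"
  shows "measure \<Omega> {\<omega> \<in> space \<Omega>. \<exists>t\<in>{1..M}. X t \<omega> \<notin> A} \<le> real M * \<epsilon>"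
proof -
  interpret prob_space \<Omega> by fact
  have s1: "{\<omega> \<in> space \<Omega>. X s \<omega> \<in> B} \<in> sets \<Omega>" if "B \<subseteq> S" for s B
    using markov_chain_from_in_sets[OF mc that] .
  have inS: "X s \<omega> \<in> S" if "\<omega> \<in> space \<Omega>" for s \<omega>
    using mc that measurable_space[of "X s" \<Omega> "count_space S"]
    by (auto simp: markov_chain_from_def)
  have ae: "AE \<omega> in \<Omega>. X 0 \<omega> = x0"
    using mc by (simp add: markov_chain_from_def)
  have e0: "0 \<le> \<epsilon>"
    using leave[OF x0] measure_nonneg order_trans by blast
  define G where "G t = {\<omega> \<in> space \<Omega>. X t \<omega> \<in> A \<and> X (Suc t) \<omega> \<in> S - A}" for t
  have G_sets: "G t \<in> sets \<Omega>" for t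
  proof -
    have "G t = {\<omega> \<in> space \<Omega>. X t \<omega> \<in> A} \<inter> {\<omega> \<in> space \<Omega>. X (Suc t) \<omega> \<in> S - A}"
      by (auto simp: G_def)
    then show ?thesis using s1[OF A] s1[of "S - A"] by auto
  qed
  have G_le: "measure \<Omega> (G t) \<le> \<epsilon>" for t
  proof -
    have "measure \<Omega> (G t) =
        (\<Sum>x\<in>A. measure \<Omega> {\<omega> \<in> space \<Omega>. X t \<omega> = x} * measure (measure_pmf (\<kappa> x)) (S - A))"
      unfolding G_def by (intro markov_chain_from_step_set[OF assms(1) mc fin A]) auto
    also have "\<dots> \<le> (\<Sum>x\<in>A. measure \<Omega> {\<omega> \<in> space \<Omega>. X t \<omega> = x} * \<epsilon>)"
      by (intro sum_mono mult_left_mono leave) auto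
    also have "\<dots> = (\<Sum>x\<in>A. measure \<Omega> {\<omega> \<in> space \<Omega>. X t \<omega> = x}) * \<epsilon>"
      by (simp add: sum_distrib_right)
    also have "(\<Sum>x\<in>A. measure \<Omega> {\<omega> \<in> space \<Omega>. X t \<omega> = x}) =
        measure \<Omega> (\<Union>x\<in>A. {\<omega> \<in> space \<Omega>. X t \<omega> = x})"
      using s1[of "{_}"] A finite_subset[OF A fin]
      by (intro finite_measure_finite_Union[symmetric]) (auto simp: disjoint_family_on_def)
    also have "\<dots> * \<epsilon> \<le> 1 * \<epsilon>"
      using e0 by (intro mult_right_mono) auto
    finally show ?thesis by simp
  qed
  have G_UN: "(\<Union>t\<in>{..<M}. G t) \<in> sets \<Omega>"
    using G_sets by auto
  \<comment> \<open>The inclusion holds only almost surely, since a path with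
    \<open>X 0 \<omega> \<noteq> x0\<close> might start outside \<open>A\<close>.\<close>
  have "AE \<omega> in \<Omega>. \<omega> \<in> {\<omega> \<in> space \<Omega>. \<exists>t\<in>{1..M}. X t \<omega> \<notin> A} \<longrightarrow> \<omega> \<in> (\<Union>t\<in>{..<M}. G t)"
    using ae
  proof eventually_elim
    case (elim \<omega>)
    show ?case
    proof
      assume "\<omega> \<in> {\<omega> \<in> space \<Omega>. \<exists>t\<in>{1..M}. X t \<omega> \<notin> A}"
      then obtain u where w: "\<omega> \<in> space \<Omega>" and u: "u \<le> M" "X u \<omega> \<notin> A" by auto
      \<comment> \<open>As \<open>t\<close> is the first time outside \<open>A\<close> and is not 0,
        its predecessor \<open>s\<close> is in \<open>A\<close> and \<open>s < M\<close>; the jump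
        event is \<open>G s\<close>.\<close>
      define t where "t = (LEAST t. X t \<omega> \<notin> A)"
      have t: "X t \<omega> \<notin> A" unfolding t_def using u(2) by (rule LeastI)
      have tu: "t \<le> u" unfolding t_def using u(2) by (rule Least_le)
      have "t \<noteq> 0" using t elim x0 by (intro notI) simp
      then obtain s where s: "t = Suc s" by (cases t) auto
      have "X s \<omega> \<in> A"
        using not_less_Least[of s "\<lambda>t. X t \<omega> \<notin> A"] s unfolding t_def by auto
      then have "\<omega> \<in> G s" using t s w inS by (auto simp: G_def)
      then show "\<omega> \<in> (\<Union>t\<in>{..<M}. G t)" using s tu u(1) by auto
    qed
  qed
  then have "measure \<Omega> {\<omega> \<in> space \<Omega>. \<exists>t\<in>{1..M}. X t \<omega> \<notin> A} \<le> measure \<Omega> (\<Union>t\<in>{..<M}. G t)"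
    by (intro finite_measure_mono_AE G_UN)
  also have "\<dots> \<le> (\<Sum>t<M. measure \<Omega> (G t))"
    using G_sets by (intro finite_measure_subadditive_finite) auto
  also have "\<dots> \<le> (\<Sum>t<M. \<epsilon>)"
    by (intro sum_mono G_le)
  finally show ?thesis by simp
qed

subsection \<open>The Ising weights\<close>

text \<open>Induction by adding a new maximum \<open>b\<close>: the ordered pairs it creates are
  exactly those in \<open>A \<times> {b}\<close>, which supply the cross term of the square.\<close>

lemma sum_square_eq_pairs:
  fixes x :: "'a::linorder \<Rightarrow> 'b::comm_ring_1"
  assumes "finite C"
  shows "(\<Sum>i\<in>C. x i)\<^sup>2 =
    (\<Sum>i\<in>C. (x i)\<^sup>2) + 2 * (\<Sum>(i, j)\<in>{(i, j). i \<in> C \<and> j \<in> C \<and> i < j}. x i * x j)"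
  using assms
proof (induction C rule: finite_linorder_max_induct)
  case empty
  then show ?case by simp
next
  case (insert b A)
  have b: "b \<notin> A" using insert.hyps by auto
  have "finite {(i, j). i \<in> A \<and> j \<in> A \<and> i < j}"
    by (rule finite_subset[of _ "A \<times> A"]) (use insert.hyps in auto)
  moreover have "{(i, j). i \<in> insert b A \<and> j \<in> insert b A \<and> i < j} =
      {(i, j). i \<in> A \<and> j \<in> A \<and> i < j} \<union> A \<times> {b}"
    using insert.hyps b by (auto dest: order.asym)
  ultimately have "(\<Sum>(i, j)\<in>{(i, j). i \<in> insert b A \<and> j \<in> insert b A \<and> i < j}. x i * x j) =
      (\<Sum>(i, j)\<in>{(i, j). i \<in> A \<and> j \<in> A \<and> i < j}. x i * x j) + (\<Sum>(i, j)\<in>A \<times> {b}. x i * x j)"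
    using insert.hyps b by (simp only:) (rule sum.union_disjoint, auto)
  also have "(\<Sum>(i, j)\<in>A \<times> {b}. x i * x j) = (\<Sum>i\<in>A. x i) * x b"
    by (simp add: sum.cartesian_product[symmetric] sum_distrib_right)
  finally show ?case
    using insert b by (simp add: power2_sum algebra_simps)
qed

lemma configs_iff:
  "x \<in> configs N \<longleftrightarrow> (\<forall>i\<in>{1..N}. x i = 1 \<or> x i = -1) \<and> (\<forall>i. i \<notin> {1..N} \<longrightarrow> x i = undefined)"
  unfolding configs_def PiE_def Pi_def extensional_def by blast

text \<open>Spins square to one, so the pair interaction depends on the block sum alone; later flips
  only have to track that sum.\<close>

lemma ising_exponent_configs:
  assumes "x \<in> configs N" and "C \<subseteq> {1..N}"
  shows "ising_exponent N C h J x =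
    (\<Sum>i=1..N. h i * x i) + J / 2 * ((\<Sum>i\<in>C. x i)\<^sup>2 - real (card C))"
proof -
  have fin: "finite C" using assms(2) finite_subset by blast
  have "(x i)\<^sup>2 = 1" if "i \<in> C" for i
    using assms that unfolding configs_iff by (auto simp: power2_eq_1_iff)
  then have "(\<Sum>i\<in>C. (x i)\<^sup>2) = real (card C)" by simp
  then have "(\<Sum>(i, j)\<in>{(i, j). i \<in> C \<and> j \<in> C \<and> i < j}. x i * x j) =
      ((\<Sum>i\<in>C. x i)\<^sup>2 - real (card C)) / 2"
    using sum_square_eq_pairs[OF fin, of x] by simp
  moreover have "(\<Sum>(i, j)\<in>{(i, j). i \<in> C \<and> j \<in> C \<and> i < j}. J * x i * x j) =
      J * (\<Sum>(i, j)\<in>{(i, j). i \<in> C \<and> j \<in> C \<and> i < j}. x i * x j)"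
    by (simp add: sum_distrib_left case_prod_unfold mult.assoc)
  ultimately show ?thesis
    by (simp add: ising_exponent_def)
qed

text \<open>The partition function cancels under conditioning, leaving a ratio of unnormalised
  weights over the fibre \<open>E\<close> of configurations that agree with \<open>x\<close> outside
  \<open>K\<close>.\<close>

lemma measure_resample_ising:
  fixes K :: "nat set"
  assumes "x \<in> configs N"
  defines "E \<equiv> {y \<in> configs N. \<forall>i\<in>{1..N} - K. y i = x i}"
  shows "measure (measure_pmf (resample N (ising_pmf N C h J) K x)) A =
    (\<Sum>y\<in>E \<inter> A. exp (ising_exponent N C h J y)) / (\<Sum>y\<in>E. exp (ising_exponent N C h J y))"
proof -
  let ?p = "ising_pmf N C h J" and ?w = "\<lambda>y. exp (ising_exponent N C h J y)"
  let ?V = "{z. \<forall>i\<in>{1..N} - K. z i = x i}" and ?Z = "ising_partition N C h J"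
  let ?q = "resample N ?p K x"
  have finE: "finite E" using finite_configs by (simp add: E_def)
  have Z: "?Z > 0" by (rule ising_partition_pos)
  have "measure (measure_pmf ?p) ?V = measure (measure_pmf ?p) (?V \<inter> set_pmf ?p)"
    by (simp add: measure_Int_set_pmf)
  also have "?V \<inter> set_pmf ?p = E" by (auto simp: set_ising_pmf E_def)
  also have "measure (measure_pmf ?p) E = (\<Sum>y\<in>E. ?w y) / ?Z"
    using finE by (simp add: measure_measure_pmf_finite pmf_ising_pmf sum_divide_distrib E_def)
  finally have V: "measure (measure_pmf ?p) ?V = (\<Sum>y\<in>E. ?w y) / ?Z" .
  have "x \<in> set_pmf ?p \<inter> ?V" using assms by (simp add: set_ising_pmf)
  then have "set_pmf ?q = E"
    unfolding resample_def by (subst set_cond_pmf) (auto simp: set_ising_pmf E_def)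
  then have "measure (measure_pmf ?q) A = measure (measure_pmf ?q) (E \<inter> A)"
    using measure_Int_set_pmf[of ?q A] by (simp add: Int_commute)
  also have "\<dots> = (\<Sum>y\<in>E \<inter> A. pmf ?q y)"
    using finE by (simp add: measure_measure_pmf_finite)
  also have "\<dots> = (\<Sum>y\<in>E \<inter> A. ?w y / (\<Sum>y\<in>E. ?w y))"
  proof (intro sum.cong refl)
    fix y assume y: "y \<in> E \<inter> A"
    then have "pmf ?q y = pmf ?p y / measure (measure_pmf ?p) ?V"
      unfolding pmf_resample_ising[OF assms(1)] by (simp add: E_def)
    also have "\<dots> = (?w y / ?Z) / ((\<Sum>y\<in>E. ?w y) / ?Z)"
      unfolding V using y by (simp add: pmf_ising_pmf E_def)
    finally show "pmf ?q y = ?w y / (\<Sum>y\<in>E. ?w y)"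
      using Z by simp
  qed
  finally show ?thesis by (simp add: sum_divide_distrib)
qed

subsection \<open>One step of the block sampler\<close>

definition flip_down :: "nat set \<Rightarrow> config \<Rightarrow> config" where
  "flip_down T z = (\<lambda>i. if i \<in> T then -1 else z i)"

text \<open>With \<open>n = card C\<close> and \<open>m = card T\<close>, the block sum drops from
  \<open>n\<close> to \<open>n - 2 * m\<close>, and the difference of squares is
  \<open>- 4 * m * (n - m)\<close>; the field contributes \<open>- 2 * h i\<close> for each flipped
  site.\<close>

lemma ising_exponent_flip_down:
  assumes C: "C \<subseteq> {1..N}" and z: "z \<in> region1 N C" and T: "T \<subseteq> C"
  shows "ising_exponent N C h J (flip_down T z) = ising_exponent N C h J z
    - 2 * (\<Sum>i\<in>T. h i) - 2 * J * (real (card T) * (real (card C) - real (card T)))"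
proof -
  have fin: "finite C" using C by (rule finite_subset) simp
  have zc: "z \<in> configs N" and z1: "\<And>i. i \<in> C \<Longrightarrow> z i = 1"
    using z by (auto simp: region1_def)
  have fc: "flip_down T z \<in> configs N"
    using zc C T unfolding configs_iff flip_down_def by auto
  have f: "flip_down T z i = z i - (if i \<in> T then 2 else 0)" for i
    using z1 T by (auto simp: flip_down_def)
  have "(\<Sum>i=1..N. h i * flip_down T z i) =
      (\<Sum>i=1..N. h i * z i) - (\<Sum>i=1..N. if i \<in> T then 2 * h i else 0)"
    unfolding sum_subtractf[symmetric] by (intro sum.cong) (auto simp: f algebra_simps)
  also have "(\<Sum>i=1..N. if i \<in> T then 2 * h i else 0) = 2 * (\<Sum>i\<in>T. h i)"
    using C T by (subst sum.inter_restrict[symmetric])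
      (auto simp: sum_distrib_left intro!: sum.cong)
  finally have 1: "(\<Sum>i=1..N. h i * flip_down T z i) = (\<Sum>i=1..N. h i * z i) - 2 * (\<Sum>i\<in>T. h i)" .
  have Sz: "(\<Sum>i\<in>C. z i) = real (card C)" using z1 by simp
  have "(\<Sum>i\<in>C. flip_down T z i) = (\<Sum>i\<in>C. z i) - (\<Sum>i\<in>C. if i \<in> T then 2 else 0)"
    unfolding sum_subtractf[symmetric] by (intro sum.cong) (auto simp: f)
  also have "(\<Sum>i\<in>C. if i \<in> T then 2 else 0) = 2 * real (card T)"
    using fin T by (simp add: sum.If_cases Int_absorb1 Int_commute)
  finally have 2: "(\<Sum>i\<in>C. flip_down T z i) = real (card C) - 2 * real (card T)"
    using Sz by simp
  show ?thesis
    unfolding ising_exponent_configs[OF fc C] ising_exponent_configs[OF zc C] 1 2 Sz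
    by (simp add: field_simps power2_eq_square)
qed

text \<open>Every configuration in the fibre arises uniquely from an all-up one by turning down a
  set \<open>T \<subseteq> C\<close>. The flip factor does not depend on the all-up configuration,
  so the total weight factors and the weight of \<open>E1\<close> cancels.\<close>

lemma resample_region1_eq:
  assumes C: "C \<subseteq> {1..N}" and K: "C \<subseteq> K" and x: "x \<in> configs N"
  shows "measure (measure_pmf (resample N (ising_pmf N C h J) K x)) (region1 N C) =
    1 / (\<Sum>T\<in>Pow C. exp (- 2 * (\<Sum>i\<in>T. h i)
          - 2 * J * (real (card T) * (real (card C) - real (card T)))))"
    (is "_ = 1 / ?R")
proof -
  let ?w = "\<lambda>y. exp (ising_exponent N C h J y)"
  define E where "E = {y \<in> configs N. \<forall>i\<in>{1..N} - K. y i = x i}"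
  define E1 where "E1 = E \<inter> region1 N C"
  have finE: "finite E" using finite_configs by (simp add: E_def)
  have up: "(\<lambda>i. if i \<in> C then 1 else y i) \<in> E1" if "y \<in> E" for y
    using that C K unfolding E1_def E_def region1_def configs_iff by auto
  have down: "flip_down T z \<in> E" if "z \<in> E1" "T \<subseteq> C" for z T
    using that C K unfolding E1_def E_def region1_def configs_iff flip_down_def by auto
  have vals: "y i = 1 \<or> y i = -1" if "y \<in> E" "i \<in> C" for y i
    using that C unfolding E_def configs_iff by blast
  have one: "z i = 1" if "z \<in> E1" "i \<in> C" for z i
    using that by (auto simp: E1_def region1_def)
  define f where "f p = flip_down (snd p) (fst p)" for p :: "config \<times> nat set"
  \<comment> \<open>The inverse of \<open>f\<close>: raise all of \<open>C\<close> and record which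
    of its spins were down.\<close>
  define g where "g y = (\<lambda>i. if i \<in> C then 1 else y i, {i \<in> C. y i = -1})" for y :: config
  have bij: "bij_betw f (E1 \<times> Pow C) E"
  proof (rule bij_betw_byWitness[where f' = g])
    show "\<forall>p\<in>E1 \<times> Pow C. g (f p) = p"
    proof
      fix p assume "p \<in> E1 \<times> Pow C"
      then obtain z T where p: "p = (z, T)" and z: "z \<in> E1" and T: "T \<subseteq> C" by auto
      have "(\<lambda>i. if i \<in> C then 1 else flip_down T z i) = z"
        using T one[OF z] by (auto simp: flip_down_def fun_eq_iff)
      moreover have "{i \<in> C. flip_down T z i = -1} = T"
        using T one[OF z] by (auto simp: flip_down_def)
      ultimately show "g (f p) = p"
        by (simp add: p f_def g_def)
    qed
    show "\<forall>y\<in>E. f (g y) = y"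
    proof
      fix y assume "y \<in> E"
      from vals[OF this] show "f (g y) = y"
        by (auto simp: f_def g_def flip_down_def fun_eq_iff)
    qed
    show "f ` (E1 \<times> Pow C) \<subseteq> E"
      using down by (auto simp: f_def)
    show "g ` E \<subseteq> E1 \<times> Pow C"
      using up by (auto simp: g_def)
  qed
  have "(\<Sum>y\<in>E. ?w y) = (\<Sum>(z, T)\<in>E1 \<times> Pow C. ?w (flip_down T z))"
    using sum.reindex_bij_betw[OF bij, of ?w] by (simp add: f_def case_prod_unfold)
  also have "\<dots> = (\<Sum>(z, T)\<in>E1 \<times> Pow C. ?w z * exp (- 2 * (\<Sum>i\<in>T. h i)
          - 2 * J * (real (card T) * (real (card C) - real (card T)))))"
  proof (intro sum.cong refl, clarify)
    fix z T assume "z \<in> E1" "T \<subseteq> C"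
    then show "?w (flip_down T z) = ?w z * exp (- 2 * (\<Sum>i\<in>T. h i)
          - 2 * J * (real (card T) * (real (card C) - real (card T))))"
      by (subst ising_exponent_flip_down[OF C]) (auto simp: E1_def exp_add[symmetric])
  qed
  also have "\<dots> = (\<Sum>z\<in>E1. ?w z) * ?R"
    by (simp add: sum_product sum.cartesian_product)
  finally have tot: "(\<Sum>y\<in>E. ?w y) = (\<Sum>z\<in>E1. ?w z) * ?R" .
  \<comment> \<open>Raising \<open>C\<close> in \<open>x\<close> stays in the fibre because
    \<open>C \<subseteq> K\<close>, so the weight to be cancelled is not zero.\<close>
  have "x \<in> E" using x by (simp add: E_def)
  then have "E1 \<noteq> {}" using up by blast
  then have pos: "(\<Sum>z\<in>E1. ?w z) > 0"
    using finE by (intro sum_pos) (auto simp: E1_def)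
  show ?thesis
    unfolding measure_resample_ising[OF x] E_def[symmetric] tot E1_def[symmetric]
    using pos by simp
qed

text \<open>The empty set gives 1 and \<open>T = C\<close> gives the field term. Every other
  \<open>T\<close> breaks at least \<open>card C - 1\<close> pairs, which costs enough to beat both
  the field and the number of subsets.\<close>

lemma region1_weight_bound:
  fixes C :: "nat set" and h :: "nat \<Rightarrow> real"
  assumes C: "C \<subseteq> {1..N}" and n: "card C \<ge> 8"
    and J: "J \<ge> J0 + (\<Sum>i=1..N. \<bar>h i\<bar>)" and J0: "J0 \<ge> 1/2 * real (card C) * ln 2"
  shows "(\<Sum>T\<in>Pow C. exp (- 2 * (\<Sum>i\<in>T. h i)
          - 2 * J * (real (card T) * (real (card C) - real (card T)))))
     \<le> 1 + exp (- 2 * (\<Sum>i\<in>C. h i)) + exp (- real (card C))"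
proof -
  have fin: "finite C" using C by (rule finite_subset) simp
  let ?n = "real (card C)" and ?H = "\<Sum>i=1..N. \<bar>h i\<bar>"
  define g where "g T = exp (- 2 * (\<Sum>i\<in>T. h i)
          - 2 * J * (real (card T) * (?n - real (card T))))" for T
  have n8: "?n \<ge> 8" using n by linarith
  have ln2: "ln 2 \<ge> (1/2 :: real)" using ln2_ge_two_thirds by linarith
  have Cne: "C \<noteq> {}" using n by auto
  have J0pos: "J0 \<ge> 0"
    by (rule order_trans[OF _ J0]) simp
  have H0: "?H \<ge> 0" by (simp add: sum_nonneg)
  have mixed: "g T \<le> exp (- (?n * ln 2 * (?n - 1)))" if T: "T \<in> Pow C - {{}, C}" for T
  proof -
    have finT: "finite T" using T fin by (auto intro: finite_subset)
    have "card T \<ge> 1" "card T < card C"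
      using T finT fin by (auto simp: Suc_le_eq card_gt_0_iff intro: psubset_card_mono)
    then have m: "real (card T) \<ge> 1" "real (card T) \<le> ?n - 1" by linarith+
    define q where "q = real (card T) * (?n - real (card T))"
    \<comment> \<open>The concave function \<open>m * (n - m)\<close> is smallest at the ends of the
      range from 1 to \<open>n - 1\<close>; the factorisation makes this explicit.\<close>
    have "q - (?n - 1) = (real (card T) - 1) * (?n - 1 - real (card T))"
      by (simp add: q_def algebra_simps)
    also have "\<dots> \<ge> 0" using m by simp
    finally have q: "q \<ge> ?n - 1" by simp
    have "- (\<Sum>i\<in>T. h i) \<le> (\<Sum>i\<in>T. \<bar>h i\<bar>)"
      by (simp add: sum_negf[symmetric] sum_mono)
    also have "\<dots> \<le> ?H"
      using T C by (intro sum_mono2) auto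
    finally have hT: "- (\<Sum>i\<in>T. h i) \<le> ?H" .
    \<comment> \<open>The part \<open>?H\<close> of \<open>J\<close> absorbs the field on
      \<open>T\<close>, and the part \<open>J0\<close> yields the decay.\<close>
    have "(J0 + ?H) * q \<le> J * q" using J q n8 by (intro mult_right_mono) auto
    then have "J0 * q + ?H * q \<le> J * q" by (simp only: distrib_right)
    moreover have "?H * 1 \<le> ?H * q" using H0 q n8 by (intro mult_left_mono) auto
    moreover have "J0 * (?n - 1) \<le> J0 * q" using J0pos q by (intro mult_left_mono) auto
    moreover have "(1/2 * ?n * ln 2) * (?n - 1) \<le> J0 * (?n - 1)"
      using J0 n8 by (intro mult_right_mono) auto
    then have "?n * ln 2 * (?n - 1) \<le> 2 * (J0 * (?n - 1))" by simp
    ultimately have "2 * (- (\<Sum>i\<in>T. h i)) - 2 * (J * q) \<le> - (?n * ln 2 * (?n - 1))"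
      using hT by linarith
    then show ?thesis by (simp add: g_def q_def)
  qed
  have "(\<Sum>T\<in>Pow C. g T) = g {} + g C + (\<Sum>T\<in>Pow C - {{}, C}. g T)"
    using fin Cne by (subst sum.subset_diff[of "{{}, C}"]) auto
  also have "(\<Sum>T\<in>Pow C - {{}, C}. g T) \<le> real (card (Pow C - {{}, C})) * exp (- (?n * ln 2 * (?n - 1)))"
    using mixed by (rule sum_bounded_above)
  also have "\<dots> \<le> 2 ^ card C * exp (- (?n * ln 2 * (?n - 1)))"
  proof (intro mult_right_mono)
    have "card (Pow C - {{}, C}) \<le> card (Pow C)"
      using fin by (intro card_mono) auto
    also have "\<dots> = 2 ^ card C"
      using fin by (rule card_Pow)
    finally have "real (card (Pow C - {{}, C})) \<le> real (2 ^ card C)"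
      by (simp only: of_nat_le_iff)
    then show "real (card (Pow C - {{}, C})) \<le> 2 ^ card C"
      by (simp only: of_nat_power of_nat_numeral)
  qed simp
  also have "(2::real) ^ card C = exp (?n * ln 2)"
    by (simp add: exp_of_nat_mult)
  also have "exp (?n * ln 2) * exp (- (?n * ln 2 * (?n - 1))) = exp (- (?n * (ln 2 * (?n - 2))))"
    by (simp add: exp_add[symmetric] algebra_simps)
  also have "\<dots> \<le> exp (- ?n)"
  proof -
    \<comment> \<open>After the count \<open>2 ^ card C\<close> is absorbed, the exponent is
      \<open>- n * ln 2 * (n - 2)\<close> with \<open>n = card C\<close>; for
      \<open>n \<ge> 8\<close> the factor \<open>ln 2 * (n - 2)\<close> is at least 3.\<close>
    have "1/2 * 6 \<le> ln 2 * (?n - 2)" using ln2 n8 by (intro mult_mono) auto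
    then have "?n * 1 \<le> ?n * (ln 2 * (?n - 2))" by (intro mult_left_mono) auto
    then show ?thesis by simp
  qed
  finally show ?thesis by (simp add: g_def)
qed

section \<open>Random blocks that contain \<open>C\<close>\<close>

lemma card_subsets_avoiding:
  assumes "i \<in> {1..N}"
  shows "card {K. K \<subseteq> {1..N} \<and> card K = k \<and> i \<notin> K} = (N - 1) choose k"
proof -
  have "{K. K \<subseteq> {1..N} \<and> card K = k \<and> i \<notin> K} = {K. K \<subseteq> {1..N} - {i} \<and> card K = k}"
    by auto
  then show ?thesis using assms by (simp add: n_subsets)
qed

text \<open>Union bound: a block that does not contain \<open>C\<close> misses some site of
  \<open>C\<close>, and each single site is missed by the fraction \<open>(N - k) / N\<close> of all
  blocks.\<close>

lemma card_supersets_ge: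
  assumes C: "C \<subseteq> {1..N}" and k: "k \<le> N" and N: "N > 0"
  shows "real (card {K. K \<subseteq> {1..N} \<and> card K = k \<and> C \<subseteq> K})
     \<ge> (1 - real (card C) * (real N - real k) / real N) * real (N choose k)"
proof -
  have fin: "finite C" using C by (rule finite_subset) simp
  let ?A = "{K. K \<subseteq> {1..N} \<and> card K = k}"
  let ?S = "{K. K \<subseteq> {1..N} \<and> card K = k \<and> C \<subseteq> K}"
  let ?B = "\<lambda>i. {K. K \<subseteq> {1..N} \<and> card K = k \<and> i \<notin> K}"
  have finPow: "finite {K. K \<subseteq> {1..N} \<and> Q K}" for Q
    by (rule finite_subset[of _ "Pow {1..N}"]) auto
  have "card ?A \<le> card (?S \<union> (\<Union>i\<in>C. ?B i))"
    using fin finPow by (intro card_mono) auto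
  also have "\<dots> \<le> card ?S + card (\<Union>i\<in>C. ?B i)"
    by (rule card_Un_le)
  also have "card (\<Union>i\<in>C. ?B i) \<le> (\<Sum>i\<in>C. card (?B i))"
    by (rule card_UN_le[OF fin])
  also have "\<dots> = (\<Sum>i\<in>C. (N - 1) choose k)"
    using C by (intro sum.cong refl card_subsets_avoiding) auto
  finally have "N choose k \<le> card ?S + card C * ((N - 1) choose k)"
    by (simp add: n_subsets)
  then have 1: "real (N choose k) \<le> real (card ?S) + real (card C) * real ((N - 1) choose k)"
    by (simp only: of_nat_add[symmetric] of_nat_mult[symmetric] of_nat_le_iff)
  have "(N - k) * (N choose k) = N * ((N - 1) choose k)"
    by (rule binomial_absorb_comp)
  then have "(real N - real k) * real (N choose k) = real N * real ((N - 1) choose k)"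
    by (simp only: of_nat_diff[OF k, symmetric] of_nat_mult[symmetric])
  then have "real ((N - 1) choose k) = (real N - real k) / real N * real (N choose k)"
    using N by (simp add: field_simps)
  then show ?thesis
    using 1 by (simp add: algebra_simps)
qed

lemma measure_bind_pmf:
  "measure (measure_pmf (bind_pmf p f)) A = (\<integral>x. measure (measure_pmf (f x)) A \<partial>measure_pmf p)"
proof -
  have "ennreal (measure (measure_pmf (bind_pmf p f)) A) =
      (\<integral>\<^sup>+x. ennreal (measure (measure_pmf (f x)) A) \<partial>measure_pmf p)"
    by (simp add: measure_pmf.emeasure_eq_measure[symmetric])
  also have "\<dots> = ennreal (\<integral>x. measure (measure_pmf (f x)) A \<partial>measure_pmf p)"
    by (intro nn_integral_eq_integral measure_pmf.integrable_const_bound[where B=1]) auto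
  finally show ?thesis
    by (simp add: integral_nonneg)
qed

text \<open>The kernel averages over blocks. Those containing \<open>C\<close> contribute at least
  \<open>q\<close> each, and the others are bounded below by zero.\<close>

lemma k_gibbs_measure_ge:
  assumes C: "C \<subseteq> {1..N}" and k: "k \<le> N" and N: "N > 0"
    and q: "0 \<le> q" "\<And>K. C \<subseteq> K \<Longrightarrow> q \<le> measure (measure_pmf (resample N p K x)) D"
  shows "measure (measure_pmf (k_gibbs_kernel N p k x)) D
     \<ge> (1 - real (card C) * (real N - real k) / real N) * q"
proof -
  define A where "A = {K. K \<subseteq> {1..N} \<and> card K = k}"
  define S where "S = {K. K \<subseteq> {1..N} \<and> card K = k \<and> C \<subseteq> K}"
  let ?r = "\<lambda>K. measure (measure_pmf (resample N p K x)) D"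
  have finA: "finite A" unfolding A_def by (rule finite_subset[of _ "Pow {1..N}"]) auto
  have cardA: "card A = N choose k" by (simp add: A_def n_subsets)
  then have pos: "card A > 0" using k by (simp add: zero_less_binomial)
  then have ne: "A \<noteq> {}" by auto
  \<comment> \<open>The inequality is multiplied by the number of blocks, so that the count of
    supersets applies directly.\<close>
  have "(1 - real (card C) * (real N - real k) / real N) * q * real (card A) =
      (1 - real (card C) * (real N - real k) / real N) * real (N choose k) * q"
    unfolding cardA by (simp only: mult_ac)
  also have "\<dots> \<le> real (card S) * q"
    unfolding S_def using q(1) by (intro mult_right_mono card_supersets_ge C k N)
  also have "\<dots> \<le> (\<Sum>K\<in>S. ?r K)"
    using q(2) by (intro sum_bounded_below) (auto simp: S_def)
  also have "\<dots> \<le> (\<Sum>K\<in>A. ?r K)"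
    using finA by (intro sum_mono2) (auto simp: A_def S_def)
  also have "\<dots> = measure (measure_pmf (k_gibbs_kernel N p k x)) D * real (card A)"
    using pos ne finA unfolding k_gibbs_kernel_def A_def[symmetric]
    by (simp add: measure_bind_pmf integral_pmf_of_set)
  finally show ?thesis using pos by simp
qed

subsection \<open>One step of the parallel sampler\<close>

text \<open>Only the two configurations that differ at \<open>i\<close> compete. Their weight ratio,
  up against down, is \<open>exp (2 * h i + 2 * J * R)\<close> with \<open>R\<close> the sum of the
  other spins of \<open>C\<close>.\<close>

lemma single_site_up_prob:
  assumes C: "C \<subseteq> {1..N}" and x: "x \<in> configs N" and S: "(\<Sum>i\<in>C. x i) \<le> -2"
    and J: "J > 0" and i: "i \<in> C" and hJ: "J - \<bar>h i\<bar> \<ge> J0"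
  shows "measure (measure_pmf (resample N (ising_pmf N C h J) {i} x)) {y. y i \<noteq> -1}
    \<le> exp (- 2 * J0)"
proof -
  let ?w = "\<lambda>y. exp (ising_exponent N C h J y)"
  have fin: "finite C" using C by (rule finite_subset) simp
  have iN: "i \<in> {1..N}" using C i by blast
  define R where "R = (\<Sum>j\<in>C - {i}. x j)"
  have xi: "x i = 1 \<or> x i = -1"
    using x iN unfolding configs_iff by blast
  have "(\<Sum>j\<in>C. x j) = x i + R"
    using fin i by (simp add: R_def sum.remove)
  \<comment> \<open>The worst case is \<open>x i = -1\<close>, which leaves at most -1 for the other
    spins.\<close>
  then have R: "R \<le> -1" using S xi by auto
  define b where "b = (\<Sum>j\<in>{1..N} - {i}. h j * x j)"
  have conf: "x(i := s) \<in> configs N" if "s = 1 \<or> s = -1" for s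
    using x iN that unfolding configs_iff by auto
  have ex: "ising_exponent N C h J (x(i := s)) =
      b + h i * s + J / 2 * ((R + s)\<^sup>2 - real (card C))" if "s = 1 \<or> s = -1" for s
  proof -
    have "(\<Sum>j=1..N. h j * (x(i := s)) j) = h i * s + (\<Sum>j\<in>{1..N} - {i}. h j * (x(i := s)) j)"
      using iN by (subst sum.remove[of _ i]) auto
    also have "(\<Sum>j\<in>{1..N} - {i}. h j * (x(i := s)) j) = b"
      unfolding b_def by (intro sum.cong) auto
    finally have 1: "(\<Sum>j=1..N. h j * (x(i := s)) j) = h i * s + b" .
    have "(\<Sum>j\<in>C. (x(i := s)) j) = s + (\<Sum>j\<in>C - {i}. (x(i := s)) j)"
      using fin i by (subst sum.remove[of _ i]) auto
    also have "(\<Sum>j\<in>C - {i}. (x(i := s)) j) = R"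
      unfolding R_def by (intro sum.cong) auto
    finally have 2: "(\<Sum>j\<in>C. (x(i := s)) j) = R + s" by simp
    show ?thesis
      unfolding ising_exponent_configs[OF conf[OF that] C] 1 2 by simp
  qed
  define E where "E = {y \<in> configs N. \<forall>j\<in>{1..N} - {i}. y j = x j}"
  have E: "E = {x(i := 1), x(i := -1)}"
  proof (intro equalityI subsetI)
    fix y assume y: "y \<in> E"
    have "y = x(i := y i)"
    proof
      fix j show "y j = (x(i := y i)) j"
        using y x unfolding E_def configs_iff by (cases "j \<in> {1..N}") auto
    qed
    moreover have "y i = 1 \<or> y i = -1"
      using y iN unfolding E_def configs_iff by blast
    ultimately have "y = x(i := 1) \<or> y = x(i := -1)" by fastforce
    then show "y \<in> {x(i := 1), x(i := -1)}" by blast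
  next
    fix y assume "y \<in> {x(i := 1), x(i := -1)}"
    then show "y \<in> E" using conf unfolding E_def by (elim insertE emptyE) simp_all
  qed
  have neq: "x(i := 1) \<noteq> x(i := -1)"
  proof
    assume "x(i := 1) = x(i := -1)"
    from fun_cong[OF this, of i] show False by simp
  qed
  have E1: "E \<inter> {y. y i \<noteq> -1} = {x(i := 1)}" unfolding E by auto
  have "measure (measure_pmf (resample N (ising_pmf N C h J) {i} x)) {y. y i \<noteq> -1}
      = ?w (x(i := 1)) / (?w (x(i := 1)) + ?w (x(i := -1)))"
    unfolding measure_resample_ising[OF x] E_def[symmetric] E1 unfolding E using neq by simp
  also have "\<dots> \<le> ?w (x(i := 1)) / ?w (x(i := -1))"
    by (intro frac_le) auto
  also have "\<dots> = exp (2 * h i + 2 * J * R)"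
  proof -
    have e1: "ising_exponent N C h J (x(i := 1)) = b + h i * 1 + J / 2 * ((R + 1)\<^sup>2 - real (card C))"
      by (rule ex) simp
    have e2: "ising_exponent N C h J (x(i := -1)) = b + h i * (-1) + J / 2 * ((R + -1)\<^sup>2 - real (card C))"
      by (rule ex) simp
    have "ising_exponent N C h J (x(i := 1)) - ising_exponent N C h J (x(i := -1)) = 2 * h i + 2 * J * R"
      unfolding e1 e2 by (simp add: power2_eq_square field_simps)
    then show ?thesis by (simp add: exp_diff[symmetric])
  qed
  also have "2 * h i + 2 * J * R \<le> - 2 * J0"
  proof -
    have "J * R \<le> J * (-1)" using J R by (intro mult_left_mono) auto
    then show ?thesis using hJ abs_ge_self[of "h i"] by (simp add: algebra_simps)
  qed
  finally show ?thesis by simp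
qed

text \<open>If every spin of \<open>C\<close> came out as -1, the sum would be
  \<open>- card C \<le> -2\<close>. So leaving requires some site to come out otherwise, and the
  single-site bounds add up.\<close>

lemma indep_parallel_leave:
  assumes C: "C \<subseteq> {1..N}" and n: "card C \<ge> 2"
    and x: "x \<in> configs N" and S: "(\<Sum>i\<in>C. x i) \<le> -2"
    and J: "J > 0" and hJ: "\<And>i. i \<in> C \<Longrightarrow> J - \<bar>h i\<bar> \<ge> J0"
  shows "measure (measure_pmf (indep_parallel_kernel N (ising_pmf N C h J) x))
     {y. (\<Sum>i\<in>C. y i) > -2} \<le> real (card C) * exp (- 2 * J0)"
proof -
  let ?k = "indep_parallel_kernel N (ising_pmf N C h J) x"
  have fin: "finite C" using C by (rule finite_subset) simp
  have "{y :: config. (\<Sum>i\<in>C. y i) > -2} \<subseteq> (\<Union>i\<in>C. {y. y i \<noteq> -1})"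
  proof
    fix y :: config assume y: "y \<in> {y. (\<Sum>i\<in>C. y i) > -2}"
    show "y \<in> (\<Union>i\<in>C. {y. y i \<noteq> -1})"
    proof (rule ccontr)
      assume "y \<notin> (\<Union>i\<in>C. {y. y i \<noteq> -1})"
      then have "(\<Sum>i\<in>C. y i) = (\<Sum>i\<in>C. -1)"
        by (intro sum.cong) auto
      then show False using y n by simp
    qed
  qed
  then have "measure (measure_pmf ?k) {y. (\<Sum>i\<in>C. y i) > -2} \<le>
      measure (measure_pmf ?k) (\<Union>i\<in>C. {y. y i \<noteq> -1})"
    by (intro measure_pmf.finite_measure_mono) auto
  also have "\<dots> \<le> (\<Sum>i\<in>C. measure (measure_pmf ?k) {y. y i \<noteq> -1})"
    by (intro measure_pmf.finite_measure_subadditive_finite fin) auto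
  also have "\<dots> \<le> (\<Sum>i\<in>C. exp (- 2 * J0))"
  proof (intro sum_mono)
    fix i assume i: "i \<in> C"
    have "measure (measure_pmf ?k) {y. y i \<noteq> -1} = measure (measure_pmf (map_pmf (\<lambda>y. y i) ?k)) {s. s \<noteq> -1}"
      by (simp add: vimage_def)
    \<comment> \<open>At a site of \<open>{1..N}\<close> the marginal of the product law is its
      factor; the default \<open>undefined\<close> concerns the other sites only.\<close>
    also have "map_pmf (\<lambda>y. y i) ?k = map_pmf (\<lambda>y. y i) (resample N (ising_pmf N C h J) {i} x)"
      using i C unfolding indep_parallel_kernel_def by (subst Pi_pmf_component) auto
    also have "measure (measure_pmf \<dots>) {s. s \<noteq> -1} =
        measure (measure_pmf (resample N (ising_pmf N C h J) {i} x)) {y. y i \<noteq> -1}"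
      by (simp add: vimage_def)
    also have "\<dots> \<le> exp (- 2 * J0)"
      using C x S J i hJ[OF i] by (rule single_site_up_prob)
    finally show "measure (measure_pmf ?k) {y. y i \<noteq> -1} \<le> exp (- 2 * J0)" .
  qed
  finally show ?thesis by simp
qed

section \<open>Choice of constants and combination of the two samplers\<close>

theorem corollary1:
  fixes N k M :: nat and C :: "nat set" and h :: "nat \<Rightarrow> real"
    and J J0 hG \<delta> :: real and x0 :: config
    and \<Omega> :: "'w measure" and X Y :: "nat \<Rightarrow> 'w \<Rightarrow> config"
  assumes C_subset: "C \<subseteq> {1..N}" and C_card: "card C \<ge> 2"
    and J_pos: "J > 0"
    and hG_def: "hG = (\<Sum>i\<in>C. h i)"
    and hG_gt: "hG > (\<Sum>i\<in>{1..N} - C. \<bar>h i\<bar>)" and hG_pos: "hG > 0"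
    and J0_pos: "J0 > 0" and J0_le: "J - (\<Sum>i=1..N. \<bar>h i\<bar>) \<ge> J0"
    and delta: "0 < \<delta>" "\<delta> < 1" and M_pos: "M \<ge> 1"
    and C_large: "real (card C) \<ge> 8 * (1 + ln (4 * real M / \<delta>))"
    and hG_large: "hG \<ge> 1/2 * ln (2 * (4 - \<delta>) / \<delta>)"
    and J0_large: "J0 \<ge> 1/2 * real (card C) * ln 2"
    and k_le: "k \<le> N"
    and k_large: "real k \<ge> max (real (card C))
          (real N - \<delta> * ((real N + 1) / ((4 - \<delta>) * real (card C) + \<delta>)))"
    and x0: "x0 \<in> configs N" and x0_sum: "(\<Sum>i\<in>C. x0 i) \<le> -2"
    and Omega: "prob_space \<Omega>"
    and k_gibbs: "markov_chain_from \<Omega> (configs N)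
          (k_gibbs_kernel N (ising_pmf N C h J) k) x0 X"
    and indep_parallel: "markov_chain_from \<Omega> (configs N)
          (indep_parallel_kernel N (ising_pmf N C h J)) x0 Y"
  shows "measure \<Omega> {\<omega> \<in> space \<Omega>. X 1 \<omega> \<in> region1 N C \<and>
            (\<lambda>t. Y t \<omega>) ` {1..M} \<inter> region1 N C = {}} \<ge> 1 - \<delta>"
proof -
  interpret prob_space \<Omega> by (rule Omega)
  define n where "n = real (card C)"
  define L where "L = ln (4 * real M / \<delta>)"
  let ?p = "ising_pmf N C h J"
  have fin: "finite C" using C_subset by (rule finite_subset) simp
  have M1: "real M \<ge> 1" using M_pos by simp
  have "1 \<le> 4 * real M / \<delta>" using M1 delta by (simp add: field_simps)
  then have L: "L \<ge> 0" and expL: "exp L = 4 * real M / \<delta>"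
    by (simp_all add: L_def)
  have n: "n \<ge> 8 * (1 + L)" using C_large by (simp add: n_def L_def)
  then have n8: "n \<ge> 8" using L by simp
  then have card8: "card C \<ge> 8" by (simp add: n_def)
  have cardN: "card C \<le> N" using card_mono[OF _ C_subset] by simp
  then have Npos: "N > 0" using card8 by linarith

  have first: "measure \<Omega> {\<omega> \<in> space \<Omega>. X 1 \<omega> \<in> region1 N C} \<ge> 1 - \<delta> / 2"
  proof -
    \<comment> \<open>The target \<open>4 / (4 - \<delta>)\<close> exceeds 1 by
      \<open>\<delta> / (4 - \<delta>)\<close>. Half of this is allotted to the all-down block, as
      given by \<open>hG_large\<close>, and half to the mixed ones.\<close>
    have "exp (- 2 * (\<Sum>i\<in>C. h i)) \<le> exp (- ln (2 * (4 - \<delta>) / \<delta>))"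
      using hG_large by (simp add: hG_def)
    also have "\<dots> = \<delta> / (2 * (4 - \<delta>))"
      using delta by (simp add: exp_minus)
    finally have down: "exp (- 2 * (\<Sum>i\<in>C. h i)) \<le> \<delta> / (2 * (4 - \<delta>))" .
    have "exp (- n) \<le> exp (- 1 - L)" using n L by simp
    also have "\<dots> = exp (- 1) * (\<delta> / (4 * real M))"
      using expL by (simp add: exp_diff)
    also have "\<dots> \<le> 1 / 2 * (\<delta> / 4)"
    proof (rule mult_mono)
      have "exp (1 :: real) \<ge> 2" using exp_ge_add_one_self[of 1] by simp
      then show "exp (- 1 :: real) \<le> 1 / 2" by (simp add: exp_minus field_simps)
      show "\<delta> / (4 * real M) \<le> \<delta> / 4" using M1 delta by (simp add: field_simps)
    qed (use delta in auto)
    also have "\<dots> \<le> \<delta> / (2 * (4 - \<delta>))"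
      using delta by (simp add: field_simps)
    finally have mixed: "exp (- n) \<le> \<delta> / (2 * (4 - \<delta>))" .
    define W where "W = (\<Sum>T\<in>Pow C. exp (- 2 * (\<Sum>i\<in>T. h i)
          - 2 * J * (real (card T) * (real (card C) - real (card T)))))"
    have "W \<le> 1 + exp (- 2 * (\<Sum>i\<in>C. h i)) + exp (- n)"
      unfolding W_def n_def using C_subset card8 J0_le J0_large
      by (intro region1_weight_bound[of C N J0]) auto
    also have "\<dots> \<le> 1 + \<delta> / (2 * (4 - \<delta>)) + \<delta> / (2 * (4 - \<delta>))"
      using down mixed by linarith
    also have "\<dots> = 4 / (4 - \<delta>)"
    proof -
      have "1 + \<delta> / (2 * u) + \<delta> / (2 * u) = (u + \<delta>) / u" if "u > 0" for u
        using that by (simp add: field_simps)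
      from this[of "4 - \<delta>"] show ?thesis using delta by simp
    qed
    finally have W: "W \<le> 4 / (4 - \<delta>)" .
    have Wpos: "W > 0"
      unfolding W_def using fin by (intro sum_pos) auto
    have "(4 - \<delta>) / 4 = 1 / (4 / (4 - \<delta>))" by simp
    also have "\<dots> \<le> 1 / W"
      using W Wpos by (intro frac_le) auto
    finally have q: "(4 - \<delta>) / 4 \<le> 1 / W" .
    \<comment> \<open>The bound on \<open>k\<close> has an extra \<open>\<delta>\<close> on both
      sides, in \<open>N + 1\<close> and in the denominator. For \<open>k < N\<close> the gap
      \<open>a = N - k\<close> is at least 1, so \<open>\<delta> \<le> a * \<delta>\<close> cancels
      them; for \<open>k = N\<close> the left side is 0.\<close>
    have frac: "n * (real N - real k) / real N \<le> \<delta> / (4 - \<delta>)"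
    proof (cases "k = N")
      case True
      then show ?thesis using delta by simp
    next
      case False
      define a where "a = real N - real k"
      have a1: "a \<ge> 1" using False k_le by (simp add: a_def)
      define d where "d = (4 - \<delta>) * n + \<delta>"
      have dpos: "d > 0" using delta n8 by (simp add: d_def add_pos_pos)
      have "a \<le> \<delta> * ((real N + 1) / d)"
        using k_large by (simp add: a_def d_def n_def)
      then have "a * d \<le> \<delta> * (real N + 1)"
        using dpos by (simp add: field_simps)
      moreover have "1 * \<delta> \<le> a * \<delta>" using a1 delta by (intro mult_right_mono) auto
      ultimately have "n * a * (4 - \<delta>) \<le> \<delta> * real N"
        by (simp add: d_def algebra_simps)
      then show ?thesis
        using Npos delta by (simp add: a_def[symmetric] field_simps)
    qed
    have "1 - \<delta> / 2 = (1 - \<delta> / (4 - \<delta>)) * ((4 - \<delta>) / 4)"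
      using delta by (simp add: field_simps)
    also have "\<dots> \<le> (1 - n * (real N - real k) / real N) * ((4 - \<delta>) / 4)"
      using frac delta by (intro mult_right_mono) auto
    also have "\<dots> \<le> measure (measure_pmf (k_gibbs_kernel N ?p k x0)) (region1 N C)"
      unfolding n_def
    proof (rule k_gibbs_measure_ge[OF C_subset k_le Npos])
      fix K assume "C \<subseteq> K"
      then show "(4 - \<delta>) / 4 \<le> measure (measure_pmf (resample N ?p K x0)) (region1 N C)"
        using q resample_region1_eq[OF C_subset _ x0, of K h J] by (simp add: W_def)
    qed (use delta in auto)
    also have "\<dots> = measure \<Omega> {\<omega> \<in> space \<Omega>. X 1 \<omega> \<in> region1 N C}"
      by (rule markov_chain_from_first_step[OF Omega k_gibbs finite_configs x0, symmetric])
        (auto simp: region1_def)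
    finally show ?thesis .
  qed

  define A where "A = {x \<in> configs N. (\<Sum>i\<in>C. x i) \<le> -2}"
  have second: "measure \<Omega> {\<omega> \<in> space \<Omega>. \<exists>t\<in>{1..M}. Y t \<omega> \<notin> A} \<le> \<delta> / 2"
  proof -
    have "measure \<Omega> {\<omega> \<in> space \<Omega>. \<exists>t\<in>{1..M}. Y t \<omega> \<notin> A} \<le> real M * (n * exp (- 2 * J0))"
    proof (rule markov_chain_from_exit[OF Omega indep_parallel finite_configs])
      show "A \<subseteq> configs N" "x0 \<in> A"
        using x0 x0_sum by (auto simp: A_def)
      fix x assume x: "x \<in> A"
      have hJ: "J - \<bar>h i\<bar> \<ge> J0" if "i \<in> C" for i
      proof -
        have "\<bar>h i\<bar> \<le> (\<Sum>i=1..N. \<bar>h i\<bar>)"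
          using that C_subset by (intro member_le_sum) auto
        then show ?thesis using J0_le by linarith
      qed
      have "measure (measure_pmf (indep_parallel_kernel N ?p x)) (configs N - A)
          \<le> measure (measure_pmf (indep_parallel_kernel N ?p x)) {y. (\<Sum>i\<in>C. y i) > -2}"
        by (intro measure_pmf.finite_measure_mono) (auto simp: A_def)
      also have "\<dots> \<le> n * exp (- 2 * J0)"
        unfolding n_def using x
        by (intro indep_parallel_leave C_subset C_card J_pos hJ) (auto simp: A_def)
      finally show "measure (measure_pmf (indep_parallel_kernel N ?p x)) (configs N - A)
          \<le> n * exp (- 2 * J0)" .
    qed
    \<comment> \<open>Each factor is compared with an exponential in \<open>n\<close>:
      \<open>M\<close> through \<open>exp L\<close> and \<open>L \<le> n / 8 - 1\<close>,
      \<open>n\<close> through \<open>1 + u \<le> exp u\<close>, and the last through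
      \<open>ln 2 \<ge> 1/2\<close>. The exponents add up to
      \<open>- n / 4 - 2 \<le> -4\<close>.\<close>
    also have "\<dots> \<le> (\<delta> / 4 * exp (n / 8 - 1)) * ((8 * exp (n / 8 - 1)) * exp (- n / 2))"
    proof (intro mult_mono)
      have "real M = \<delta> / 4 * exp L" using expL delta by simp
      also have "\<dots> \<le> \<delta> / 4 * exp (n / 8 - 1)"
        using n delta by (intro mult_left_mono) auto
      finally show "real M \<le> \<delta> / 4 * exp (n / 8 - 1)" .
      show "n \<le> 8 * exp (n / 8 - 1)"
        using exp_ge_add_one_self[of "n / 8 - 1"] by simp
      have "n * (1/2) \<le> n * ln 2"
        using n8 ln2_ge_two_thirds by (intro mult_left_mono) auto
      then show "exp (- 2 * J0) \<le> exp (- n / 2)"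
        using J0_large by (simp add: n_def)
    qed (use n8 delta in auto)
    also have "\<dots> = 2 * \<delta> * exp (- n / 4 - 2)"
    proof -
      have "exp (- n / 4 - 2) = exp (n / 8 - 1) * (exp (n / 8 - 1) * exp (- n / 2))"
        unfolding exp_add[symmetric] by (rule arg_cong[where f = exp]) simp
      then show ?thesis by simp
    qed
    also have "\<dots> \<le> 2 * \<delta> * (1 / 5)"
    proof (intro mult_left_mono)
      have "exp (- n / 4 - 2) \<le> exp (- 4)" using n8 by simp
      also have "\<dots> \<le> 1 / (5 :: real)"
        using exp_ge_add_one_self[of "4 :: real"] by (simp add: exp_minus field_simps)
      finally show "exp (- n / 4 - 2) \<le> 1 / 5" .
    qed (use delta in auto)
    also have "\<dots> \<le> \<delta> / 2" using delta by simp
    finally show ?thesis .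
  qed

  have disj: "A \<inter> region1 N C = {}"
    using card8 by (auto simp: A_def region1_def)
  have subs: "region1 N C \<subseteq> configs N" "A \<subseteq> configs N" "configs N - A \<subseteq> configs N"
    by (auto simp: region1_def A_def)
  let ?X = "{\<omega> \<in> space \<Omega>. X 1 \<omega> \<in> region1 N C}"
  let ?B = "{\<omega> \<in> space \<Omega>. \<exists>t\<in>{1..M}. Y t \<omega> \<notin> A}"
  let ?G = "{\<omega> \<in> space \<Omega>. X 1 \<omega> \<in> region1 N C \<and> (\<lambda>t. Y t \<omega>) ` {1..M} \<inter> region1 N C = {}}"
  have X_sets: "?X \<in> sets \<Omega>"
    by (rule markov_chain_from_in_sets[OF k_gibbs subs(1)])
  have "?B = (\<Union>t\<in>{1..M}. space \<Omega> - {\<omega> \<in> space \<Omega>. Y t \<omega> \<in> A})"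
    by auto
  then have B_sets: "?B \<in> sets \<Omega>"
    by (simp only:)
      (intro sets.finite_UN sets.Diff sets.top markov_chain_from_in_sets[OF indep_parallel subs(2)] finite_atLeastAtMost)
  have "?G = ?X - (\<Union>t\<in>{1..M}. {\<omega> \<in> space \<Omega>. Y t \<omega> \<in> region1 N C})"
    by auto
  then have G_sets: "?G \<in> sets \<Omega>"
    by (simp only:)
      (intro sets.finite_UN sets.Diff X_sets markov_chain_from_in_sets[OF indep_parallel subs(1)] finite_atLeastAtMost)
  \<comment> \<open>The two chains share \<open>\<Omega>\<close> with an arbitrary joint law, so
    their failure probabilities, \<open>\<delta> / 2\<close> each, are simply added.\<close>
  have "?X \<subseteq> ?G \<union> ?B" using disj by auto
  then have "measure \<Omega> ?X \<le> measure \<Omega> (?G \<union> ?B)"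
    using G_sets B_sets by (intro finite_measure_mono) auto
  also have "\<dots> \<le> measure \<Omega> ?G + measure \<Omega> ?B"
    using G_sets B_sets by (rule measure_Un_le)
  finally show ?thesis using first second by linarith
qed

end
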